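(* Let $S_{\boldsymbol\lambda}$ be a weighted shift on a directed tree $\mathcal{T}=(V,E)$ with weights $\boldsymbol\lambda=\{\lambda_v\}_{v\in V^\circ}\subseteq\mathbb{C}$. Then the following conditions are equivalent: (i) $\mathscr{E}_V\subseteq\mathcal{D}^\infty(S_{\boldsymbol\lambda})$, (ii) $\mathcal{D}^\infty(S_{\boldsymbol\lambda})$ is dense in $\ell^2(V)$, (iii) $S_{\boldsymbol\lambda}^n$ is densely defined for every $n\in\mathbb{Z}_+$. Moreover, if any of the equivalent conditions (i), (ii), (iii) holds, then $\mathcal{D}^\infty(S_{\boldsymbol\lambda})$ is a core of $S_{\boldsymbol\lambda}^n$ for every $n\in\mathbb{Z}_+$.
   Context: $\mathbb{Z}_+=\{0,1,2,\ldots\}$. A directed tree $\mathcal{T}=(V,E)$ is a nonempty directed graph (vertices $V$, edges $E\subseteq V\times V$) which is connected (as an undirected graph), has no circuits, and in which each vertex $v$ has at most one $u$ with $(u,v)\in E$; this $u$ is denoted $\mathrm{par}(v)$. A vertex with no parent is called the root (there is at most one). $V^\circ=V\setminus\{\text{root}\}$ if there is a root and $V^\circ=V$ otherwise. $\ell^2(V)$ is the complex Hilbert space of square summable complex functions on $V$; $e_u$ is the characteristic function of $\{u\}$; $\mathscr{E}_V$ is the linear span of $\{e_u\colon u\in V\}$. The weighted shift $S_{\boldsymbol\lambda}$ is the operator in $\ell^2(V)$ with $\mathcal{D}(S_{\boldsymbol\lambda})=\{f\in\ell^2(V)\colon\Lambda f\in\ell^2(V)\}$, $S_{\boldsymbol\lambda}f=\Lambda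 f$, where $(\Lambda f)(v)=\lambda_vf(\mathrm{par}(v))$ for $v\in V^\circ$ and $(\Lambda f)(v)=0$ if $v$ is the root. $\mathcal{D}^\infty(A)=\bigcap_{n=0}^\infty\mathcal{D}(A^n)$. A linear subspace $\mathcal{E}\subseteq\mathcal{D}(A)$ is a core of an operator $A$ if the graph of $A$ is contained in the closure of the graph of $A|_{\mathcal{E}}$. *)

theory Defs
  imports "Graph_Theory.Digraph_Component" "HOL-Analysis.Analysis"
begin

section \<open>The complex Hilbert space of square summable functions\<close>

definition square_summable :: "('v \<Rightarrow> complex) \<Rightarrow> bool" where
  "square_summable f \<longleftrightarrow> (\<lambda>v. (cmod (f v))\<^sup>2) summable_on UNIV"

lemma square_summable_zero: "square_summable (\<lambda>_. 0)"
  by (simp add: square_summable_def)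

lemma square_summable_add:
  assumes "square_summable f" "square_summable g"
  shows "square_summable (\<lambda>v. f v + g v)"
  unfolding square_summable_def
proof (rule summable_on_comparison_test)
  show "(\<lambda>v. 2 * (cmod (f v))\<^sup>2 + 2 * (cmod (g v))\<^sup>2) summable_on UNIV"
    using assms unfolding square_summable_def
    by (intro summable_on_add summable_on_cmult_right)
  fix v
  have "(cmod (f v + g v))\<^sup>2 \<le> (cmod (f v) + cmod (g v))\<^sup>2"
    by (intro power_mono norm_triangle_ineq norm_ge_zero)
  also have "\<dots> \<le> 2 * (cmod (f v))\<^sup>2 + 2 * (cmod (g v))\<^sup>2"
    using sum_squares_bound[of "cmod (f v)" "cmod (g v)"] by (simp add: power2_sum)
  finally show "(cmod (f v + g v))\<^sup>2 \<le> 2 * (cmod (f v))\<^sup>2 + 2 * (cmod (g v))\<^sup>2" .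
qed simp

lemma square_summable_scale:
  assumes "square_summable f"
  shows "square_summable (\<lambda>v. c * f v)"
  using assms unfolding square_summable_def
  by (simp add: norm_mult power_mult_distrib summable_on_cmult_right)

typedef 'v ell2 = "{f :: 'v \<Rightarrow> complex. square_summable f}"
  morphisms ell2_apply Abs_ell2
  by (rule exI[of _ "\<lambda>_. 0"]) (simp add: square_summable_zero)

setup_lifting type_definition_ell2

lift_definition ell2_scale :: "complex \<Rightarrow> 'v ell2 \<Rightarrow> 'v ell2" is "\<lambda>c f v. c * f v"
  by (rule square_summable_scale)

text \<open>The characteristic function of a singleton.\<close>

lift_definition ell2_unit :: "'v \<Rightarrow> 'v ell2" is "\<lambda>u v. if v = u then 1 else 0"
proof -
  fix u :: 'v
  have "(\<lambda>v. (cmod (if v = u then 1 else 0))\<^sup>2) summable_on {u}"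
    by (rule summable_on_finite) simp
  then show "square_summable (\<lambda>v. if v = u then 1 else 0)"
    unfolding square_summable_def
    by (rule iffD1[OF summable_on_cong_neutral, rotated -1]) auto
qed

instantiation ell2 :: (type) ab_group_add
begin

lift_definition zero_ell2 :: "'a ell2" is "\<lambda>_. 0"
  by (rule square_summable_zero)

lift_definition plus_ell2 :: "'a ell2 \<Rightarrow> 'a ell2 \<Rightarrow> 'a ell2" is "\<lambda>f g v. f v + g v"
  by (rule square_summable_add)

lift_definition uminus_ell2 :: "'a ell2 \<Rightarrow> 'a ell2" is "\<lambda>f v. - f v"
  by (simp add: square_summable_def)

lift_definition minus_ell2 :: "'a ell2 \<Rightarrow> 'a ell2 \<Rightarrow> 'a ell2" is "\<lambda>f g v. f v - g v"
  subgoal for f g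
    using square_summable_add[of f "\<lambda>v. - g v"] by (simp add: square_summable_def)
  done

instance
  by standard (transfer; simp add: fun_eq_iff)+

end

instantiation ell2 :: (type) real_normed_vector
begin

definition scaleR_ell2 :: "real \<Rightarrow> 'a ell2 \<Rightarrow> 'a ell2" where
  "scaleR_ell2 r f = ell2_scale (complex_of_real r) f"

definition norm_ell2 :: "'a ell2 \<Rightarrow> real" where
  "norm_ell2 f = sqrt (\<Sum>\<^sub>\<infinity>v. (cmod (ell2_apply f v))\<^sup>2)"

definition dist_ell2 :: "'a ell2 \<Rightarrow> 'a ell2 \<Rightarrow> real" where
  "dist_ell2 f g = norm (f - g)"

definition sgn_ell2 :: "'a ell2 \<Rightarrow> 'a ell2" where
  "sgn_ell2 f = inverse (norm f) *\<^sub>R f"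

definition uniformity_ell2 :: "('a ell2 \<times> 'a ell2) filter" where
  "uniformity_ell2 = (INF e\<in>{0<..}. principal {(x, y). dist x y < e})"

definition open_ell2 :: "'a ell2 set \<Rightarrow> bool" where
  "open_ell2 U \<longleftrightarrow> (\<forall>x\<in>U. \<forall>\<^sub>F (x', y) in uniformity. x' = x \<longrightarrow> y \<in> U)"

instance
proof
  fix f g :: "'a ell2" and a b :: real
  have sq: "(\<lambda>v. (cmod (ell2_apply h v))\<^sup>2) summable_on UNIV" for h :: "'a ell2"
    using ell2_apply[of h] by (simp add: square_summable_def)
  show "a *\<^sub>R (f + g) = a *\<^sub>R f + a *\<^sub>R g"
    unfolding scaleR_ell2_def by transfer (simp add: algebra_simps)
  show "(a + b) *\<^sub>R f = a *\<^sub>R f + b *\<^sub>R f"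
    unfolding scaleR_ell2_def by transfer (simp add: algebra_simps)
  show "a *\<^sub>R b *\<^sub>R f = (a * b) *\<^sub>R f"
    unfolding scaleR_ell2_def by transfer (simp add: algebra_simps)
  show "1 *\<^sub>R f = f"
    unfolding scaleR_ell2_def by transfer simp
  show "dist f g = norm (f - g)" by (rule dist_ell2_def)
  show "sgn f = inverse (norm f) *\<^sub>R f" by (rule sgn_ell2_def)
  show "uniformity = (INF e\<in>{0<..}. principal {(x :: 'a ell2, y). dist x y < e})"
    by (rule uniformity_ell2_def)
  show "open U \<longleftrightarrow> (\<forall>x\<in>U. \<forall>\<^sub>F (x', y) in uniformity. x' = x \<longrightarrow> y \<in> U)" for U :: "'a ell2 set"
    by (rule open_ell2_def)
  show "norm f = 0 \<longleftrightarrow> f = 0"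
  proof
    assume "norm f = 0"
    then have "(\<Sum>\<^sub>\<infinity>v. (cmod (ell2_apply f v))\<^sup>2) \<le> 0"
      by (simp add: norm_ell2_def)
    then have "(cmod (ell2_apply f v))\<^sup>2 = 0" for v
      by (rule nonneg_infsum_le_0D[OF _ sq]) auto
    then have "ell2_apply f = (\<lambda>_. 0)" by (simp add: fun_eq_iff)
    then show "f = 0" by (simp add: ell2_apply_inject[symmetric] zero_ell2.rep_eq)
  next
    assume "f = 0"
    then show "norm f = 0" by (simp add: norm_ell2_def zero_ell2.rep_eq)
  qed
  show "norm (f + g) \<le> norm f + norm g"
  proof -
    have L2: "L2_set (\<lambda>v. cmod (ell2_apply h v)) F \<le> norm h" if "finite F" for F and h :: "'a ell2"
      unfolding L2_set_def norm_ell2_def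
      by (intro real_sqrt_le_mono finite_sum_le_infsum sq that) auto
    have nn: "0 \<le> norm h" for h :: "'a ell2"
      unfolding norm_ell2_def by (simp add: infsum_nonneg)
    have "(\<Sum>\<^sub>\<infinity>v. (cmod (ell2_apply (f + g) v))\<^sup>2) \<le> (norm f + norm g)\<^sup>2"
    proof (rule infsum_le_finite_sums[OF sq])
      fix F :: "'a set" assume F: "finite F"
      have "L2_set (\<lambda>v. cmod (ell2_apply (f + g) v)) F
          \<le> L2_set (\<lambda>v. cmod (ell2_apply f v) + cmod (ell2_apply g v)) F"
        by (intro L2_set_mono) (auto simp: plus_ell2.rep_eq norm_triangle_ineq)
      also have "\<dots> \<le> L2_set (\<lambda>v. cmod (ell2_apply f v)) F + L2_set (\<lambda>v. cmod (ell2_apply g v)) F"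
        by (rule L2_set_triangle_ineq)
      also have "\<dots> \<le> norm f + norm g"
        by (intro add_mono L2 F)
      finally have "sqrt (\<Sum>v\<in>F. (cmod (ell2_apply (f + g) v))\<^sup>2) \<le> norm f + norm g"
        by (simp add: L2_set_def)
      then show "(\<Sum>v\<in>F. (cmod (ell2_apply (f + g) v))\<^sup>2) \<le> (norm f + norm g)\<^sup>2"
        by (rule sqrt_le_D)
    qed
    then show ?thesis
      unfolding norm_ell2_def[of "f + g"]
      by (intro real_le_lsqrt) (use nn[of f] nn[of g] in auto)
  qed
  show "norm (a *\<^sub>R f) = \<bar>a\<bar> * norm f"
    by (simp add: norm_ell2_def scaleR_ell2_def ell2_scale.rep_eq norm_mult power_mult_distrib
        infsum_cmult_right' real_sqrt_mult)
qed

end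

text \<open>Complex linear span and complex subspaces are \<open>ell2.span\<close> and \<open>ell2.subspace\<close>.\<close>

interpretation ell2: vector_space "ell2_scale :: complex \<Rightarrow> 'v ell2 \<Rightarrow> 'v ell2"
  by standard (transfer; simp add: algebra_simps)+

text \<open>
  \<open>ell2_on V\<close> is the Hilbert space of square summable functions on the set \<open>V\<close>, realised as
  the closed subspace of functions on the whole type that vanish off \<open>V\<close>.
\<close>

definition ell2_on :: "'v set \<Rightarrow> 'v ell2 set" where
  "ell2_on V = {f. \<forall>v. v \<notin> V \<longrightarrow> ell2_apply f v = 0}"

definition unit_span :: "'v set \<Rightarrow> 'v ell2 set" where
  "unit_span V = ell2.span (ell2_unit ` V)"


section \<open>Unbounded operators\<close>

text \<open>
  An operator \<open>A\<close> in a space \<open>H\<close> is a partial map, with domain \<open>dom A\<close> and graph \<open>Map.graph A\<close>.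
  The space \<open>H\<close> is needed as a parameter because the zeroth power is the identity on \<open>H\<close>.
\<close>

primrec op_power :: "'h set \<Rightarrow> ('h \<rightharpoonup> 'h) \<Rightarrow> nat \<Rightarrow> ('h \<rightharpoonup> 'h)" where
  "op_power H A 0 = Some |` H"
| "op_power H A (Suc n) = A \<circ>\<^sub>m op_power H A n"

definition dom_infty :: "'h set \<Rightarrow> ('h \<rightharpoonup> 'h) \<Rightarrow> 'h set" where
  "dom_infty H A = (\<Inter>n. dom (op_power H A n))"

definition dense_in :: "'h::topological_space set \<Rightarrow> 'h set \<Rightarrow> bool" where
  "dense_in H D \<longleftrightarrow> D \<subseteq> H \<and> H \<subseteq> closure D"

definition densely_defined :: "'h::topological_space set \<Rightarrow> ('h \<rightharpoonup> 'h) \<Rightarrow> bool" where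
  "densely_defined H A \<longleftrightarrow> dense_in H (dom A)"

definition is_core :: "'v ell2 set \<Rightarrow> ('v ell2 \<rightharpoonup> 'v ell2) \<Rightarrow> bool" where
  "is_core D A \<longleftrightarrow> ell2.subspace D \<and> D \<subseteq> dom A
     \<and> Map.graph A \<subseteq> closure (Map.graph (A |` D))"


section \<open>Directed trees and weighted shifts\<close>

text \<open>
  \<open>tree\<close> demands that the underlying undirected graph is nonempty and connected, and that there
  is no directed cycle, loops counting as cycles. Vertex sets may be infinite.
\<close>

definition directed_tree :: "'v pair_pre_digraph \<Rightarrow> bool" where
  "directed_tree T \<longleftrightarrow> pair_wf_digraph T \<and> tree (with_proj T)
     \<and> (\<forall>u u' v. (u, v) \<in> parcs T \<longrightarrow> (u', v) \<in> parcs T \<longrightarrow> u = u')"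

definition par :: "'v pair_pre_digraph \<Rightarrow> 'v \<Rightarrow> 'v" where
  "par T v = (THE u. (u, v) \<in> parcs T)"

definition is_root :: "'v pair_pre_digraph \<Rightarrow> 'v \<Rightarrow> bool" where
  "is_root T v \<longleftrightarrow> v \<in> pverts T \<and> (\<nexists>u. (u, v) \<in> parcs T)"

definition nonroot_verts :: "'v pair_pre_digraph \<Rightarrow> 'v set" where
  "nonroot_verts T = pverts T - {v. is_root T v}"

definition shift_map :: "'v pair_pre_digraph \<Rightarrow> ('v \<Rightarrow> complex) \<Rightarrow> ('v \<Rightarrow> complex) \<Rightarrow> ('v \<Rightarrow> complex)" where
  "shift_map T wt f v = (if v \<in> nonroot_verts T then wt v * f (par T v) else 0)"

text \<open>Only the weights at the vertices in \<open>nonroot_verts T\<close> matter.\<close>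

definition weighted_shift :: "'v pair_pre_digraph \<Rightarrow> ('v \<Rightarrow> complex) \<Rightarrow> ('v ell2 \<rightharpoonup> 'v ell2)" where
  "weighted_shift T wt f =
     (if f \<in> ell2_on (pverts T) \<and> square_summable (shift_map T wt (ell2_apply f))
      then Some (Abs_ell2 (shift_map T wt (ell2_apply f))) else None)"

end

theory Submission
  imports Defs
begin

text \<open>
  The iterates of the shift have the form \<open>f \<mapsto> w\<^sub>n \<cdot> (f \<circ> par\<^sup>n)\<close>, so the domain of each power is
  closed under pointwise domination up to a constant, and restricting \<open>f\<close> to \<open>F\<close> restricts its
  image to the preimage of \<open>F\<close> under \<open>par\<^sup>n\<close>. If the \<open>n\<close>-th power is densely defined, its domain
  contains some \<open>f\<close> with \<open>f(u) \<noteq> 0\<close>, and \<open>f\<close> dominates a multiple of \<open>e\<^sub>u\<close>; this gives (iii)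
  \<open>\<Longrightarrow>\<close> (i). For the core, the restrictions of \<open>f\<close> to finite sets lie in the span of the \<open>e\<^sub>u\<close>, and
  they converge to \<open>f\<close> in the graph norm of every power whose domain contains \<open>f\<close>.
\<close>

section \<open>Pointwise domination and evaluation in the space of square summable functions\<close>

lemma square_summable_mono:
  assumes "square_summable g" and "\<And>v. cmod (f v) \<le> cmod (g v)"
  shows "square_summable f"
  using assms(1) unfolding square_summable_def
  by (rule summable_on_comparison_test) (auto intro: power_mono assms(2))

lemma square_summable_ell2_apply: "square_summable (ell2_apply f)"
  using ell2_apply[of f] by simp

lemma ell2_apply_Abs: "square_summable f \<Longrightarrow> ell2_apply (Abs_ell2 f) = f"
  by (simp add: Abs_ell2_inverse)

lemma ell2_eqI: "(\<And>v. ell2_apply f v = ell2_apply g v) \<Longrightarrow> f = g"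
  by (simp add: ell2_apply_inject[symmetric] fun_eq_iff)

text \<open>One term of a series of nonnegative numbers is at most its sum. Evaluation at a vertex
  is thus continuous, so approximation in norm controls single coordinates.\<close>

lemma cmod_ell2_apply_le_norm: "cmod (ell2_apply f v) \<le> norm f"
proof -
  have "(\<Sum>v\<in>{v}. (cmod (ell2_apply f v))\<^sup>2) \<le> (\<Sum>\<^sub>\<infinity>v. (cmod (ell2_apply f v))\<^sup>2)"
    by (rule finite_sum_le_infsum)
      (use square_summable_ell2_apply[of f] in \<open>auto simp: square_summable_def\<close>)
  then show ?thesis
    unfolding norm_ell2_def by (intro real_le_rsqrt) simp
qed


section \<open>Restrictions to subsets\<close>

lift_definition ell2_restrict :: "'v set \<Rightarrow> 'v ell2 \<Rightarrow> 'v ell2"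
  is "\<lambda>F f v. if v \<in> F then f v else 0"
  by (erule square_summable_mono) simp

lemma tendsto_ell2_restrict_vimage:
  "((\<lambda>F. ell2_restrict (q -` F) g) \<longlongrightarrow> g) (finite_subsets_at_top UNIV)"
proof -
  define a where "a v = (cmod (ell2_apply g v))\<^sup>2" for v
  have a: "a summable_on B" for B
    using square_summable_ell2_apply[of g]
    unfolding a_def square_summable_def by (rule summable_on_subset_banach) simp
  have a0: "0 \<le> a v" for v
    by (simp add: a_def)
  show ?thesis
  proof (rule tendstoI)
    fix e :: real assume e: "0 < e"
    have "(sum a \<longlongrightarrow> infsum a UNIV) (finite_subsets_at_top UNIV)"
      using has_sum_infsum[OF a[of UNIV]] by (simp add: has_sum_def)
    then have "\<forall>\<^sub>F G in finite_subsets_at_top UNIV. infsum a UNIV - e\<^sup>2 < sum a G"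
      by (rule order_tendstoD) (use e in simp)
    then obtain G where G: "finite G" "infsum a UNIV - e\<^sup>2 < sum a G"
      by (auto simp: eventually_finite_subsets_at_top)
    \<comment> \<open>The finite set \<open>G\<close> carries all but less than \<open>e^2\<close>
      of the squared norm, and \<open>q -\<close>
      F\<open>contains\<close>G\<open>once\<close>F\<open>contains the finite set\<close>q
      \<open>G\<close>.\<close>
    have "dist (ell2_restrict (q -` F) g) g < e" if F: "finite F" "q ` G \<subseteq> F" for F
    proof -
      let ?B = "q -` F"
      have "infsum a UNIV = infsum a ?B + infsum a (- ?B)"
        using infsum_Un_disjoint[OF a a, of ?B "- ?B"] by simp
      moreover have "sum a G \<le> infsum a ?B"
        by (rule finite_sum_le_infsum[OF a G(1)]) (use F(2) a0 in auto)
      moreover have "infsum a (- ?B)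
          = (\<Sum>\<^sub>\<infinity>v. (cmod (ell2_apply (g - ell2_restrict ?B g) v))\<^sup>2)"
        by (rule infsum_cong_neutral)
          (auto simp: a_def minus_ell2.rep_eq ell2_restrict.rep_eq)
      ultimately have "(\<Sum>\<^sub>\<infinity>v. (cmod (ell2_apply (g - ell2_restrict ?B g) v))\<^sup>2) < e\<^sup>2"
        using G(2) by linarith
      then have "norm (g - ell2_restrict ?B g) < e"
        unfolding norm_ell2_def using e by (intro real_less_lsqrt) auto
      then show ?thesis
        by (simp add: dist_norm norm_minus_commute)
    qed
    then show "\<forall>\<^sub>F F in finite_subsets_at_top UNIV. dist (ell2_restrict (q -` F) g) g < e"
      unfolding eventually_finite_subsets_at_top using G(1)
      by (intro exI[of _ "q ` G"]) auto
  qed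
qed

lemma tendsto_ell2_restrict: "((\<lambda>F. ell2_restrict F f) \<longlongrightarrow> f) (finite_subsets_at_top UNIV)"
  using tendsto_ell2_restrict_vimage[of "\<lambda>v. v" f] by simp

lemma ell2_restrict_in_unit_span:
  assumes "finite F" and f: "f \<in> ell2_on V"
  shows "ell2_restrict F f \<in> unit_span V"
  using assms(1)
proof (induction F)
  case empty
  have "ell2_restrict {} f = 0"
    by (rule ell2_eqI) (simp add: ell2_restrict.rep_eq zero_ell2.rep_eq)
  then show ?case
    by (simp add: unit_span_def ell2.span_zero)
next
  case (insert x F)
  have eq: "ell2_restrict (insert x F) f
      = ell2_restrict F f + ell2_scale (ell2_apply f x) (ell2_unit x)"
    by (rule ell2_eqI)
      (use insert.hyps in \<open>auto simp: ell2_restrict.rep_eq plus_ell2.rep_eq ell2_scale.rep_eq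
        ell2_unit.rep_eq\<close>)
  \<comment> \<open>\<open>F\<close> may contain points outside \<open>V\<close>; there the
    coefficient vanishes.\<close>
  have "ell2_scale (ell2_apply f x) (ell2_unit x) \<in> unit_span V"
  proof (cases "x \<in> V")
    case True
    then show ?thesis
      unfolding unit_span_def by (intro ell2.span_scale ell2.span_base) auto
  next
    case False
    with f have "ell2_apply f x = 0"
      by (simp add: ell2_on_def)
    then show ?thesis
      by (simp add: unit_span_def ell2.span_zero)
  qed
  with insert.IH show ?case
    unfolding eq unit_span_def by (intro ell2.span_add)
qed

lemma ell2_on_subset_closure_unit_span:
  fixes V :: "'v set"
  shows "ell2_on V \<subseteq> closure (unit_span V)"
proof
  fix f :: "'v ell2" assume f: "f \<in> ell2_on V"
  show "f \<in> closure (unit_span V)"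
  proof (rule Lim_in_closed_set[OF closed_closure _ _ tendsto_ell2_restrict])
    show "\<forall>\<^sub>F F in finite_subsets_at_top UNIV. ell2_restrict F f \<in> closure (unit_span V)"
      by (rule eventually_finite_subsets_at_top_weakI)
        (use f ell2_restrict_in_unit_span closure_subset in blast)
  qed simp
qed


section \<open>Powers of a weighted shift\<close>

text \<open>The product of the weights met on climbing \<open>n\<close> edges from \<open>v\<close>.
  It is 0 when the climb cannot be made, which cancels the unspecified value of \<open>par\<close>
  at the root and off the tree.\<close>

primrec iter_weight :: "'v pair_pre_digraph \<Rightarrow> ('v \<Rightarrow> complex) \<Rightarrow> nat \<Rightarrow> 'v \<Rightarrow> complex" where
  "iter_weight T wt 0 v = 1"
| "iter_weight T wt (Suc n) v
    = (if v \<in> nonroot_verts T then wt v * iter_weight T wt n (par T v) else 0)"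

definition shift_iter ::
    "'v pair_pre_digraph \<Rightarrow> ('v \<Rightarrow> complex) \<Rightarrow> nat \<Rightarrow> ('v \<Rightarrow> complex) \<Rightarrow> 'v \<Rightarrow> complex" where
  "shift_iter T wt n f v = iter_weight T wt n v * f ((par T ^^ n) v)"

lemma shift_iter_0: "shift_iter T wt 0 f = f"
  by (simp add: shift_iter_def fun_eq_iff)

lemma shift_map_shift_iter: "shift_map T wt (shift_iter T wt n f) = shift_iter T wt (Suc n) f"
  by (simp add: shift_iter_def shift_map_def fun_eq_iff funpow_swap1)

text \<open>After at least one step the weight factor vanishes off \<open>nonroot_verts T\<close>,
  whatever \<open>f\<close> is. For zero steps the support of \<open>f\<close> itself decides, hence
  the \<open>Suc\<close>.\<close>

lemma Abs_ell2_shift_iter_Suc_in_ell2_on: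
  assumes "square_summable (shift_iter T wt (Suc n) f)"
  shows "Abs_ell2 (shift_iter T wt (Suc n) f) \<in> ell2_on (pverts T)"
  by (simp add: ell2_on_def ell2_apply_Abs[OF assms] shift_iter_def nonroot_verts_def)

text \<open>Every \<open>k \<le> n\<close> occurs because all intermediate images must be square
  summable; with zero weights the last one may be so although an earlier one is not.\<close>

lemma op_power_weighted_shift:
  "op_power (ell2_on (pverts T)) (weighted_shift T wt) n f
    = (if f \<in> ell2_on (pverts T) \<and> (\<forall>k\<le>n. square_summable (shift_iter T wt k (ell2_apply f)))
       then Some (Abs_ell2 (shift_iter T wt n (ell2_apply f))) else None)"
proof (induction n)
  case 0
  show ?case
    by (simp add: shift_iter_0 square_summable_ell2_apply ell2_apply_inverse restrict_map_def)
next
  case (Suc n)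
  let ?h = "\<lambda>n. shift_iter T wt n (ell2_apply f)"
  show ?case
  proof (cases "f \<in> ell2_on (pverts T) \<and> (\<forall>k\<le>n. square_summable (?h k))")
    case True
    then have s: "square_summable (?h n)"
      by simp
    have "Abs_ell2 (?h n) \<in> ell2_on (pverts T)"
    proof (cases n)
      case 0
      with True show ?thesis
        by (simp add: shift_iter_0 ell2_apply_inverse)
    next
      case (Suc m)
      with s show ?thesis
        using Abs_ell2_shift_iter_Suc_in_ell2_on by blast
    qed
    with True s Suc.IH show ?thesis
      by (auto simp: map_comp_def weighted_shift_def ell2_apply_Abs shift_map_shift_iter le_Suc_eq)
  next
    case False
    moreover from this
    have "\<not> (f \<in> ell2_on (pverts T) \<and> (\<forall>k\<le>Suc n. square_summable (?h k)))"
      using le_SucI by blast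
    ultimately show ?thesis
      using Suc.IH by (simp only: op_power.simps map_comp_def if_False option.case)
  qed
qed

section \<open>Domains of the powers\<close>

lemma dom_op_power_weighted_shift:
  "f \<in> dom (op_power (ell2_on (pverts T)) (weighted_shift T wt) n)
    \<longleftrightarrow> f \<in> ell2_on (pverts T) \<and> (\<forall>k\<le>n. square_summable (shift_iter T wt k (ell2_apply f)))"
  by (simp add: dom_def op_power_weighted_shift)

lemma subspace_dom_op_power:
  "ell2.subspace (dom (op_power (ell2_on (pverts T)) (weighted_shift T wt) n))"
proof (rule ell2.subspaceI)
  let ?D = "dom (op_power (ell2_on (pverts T)) (weighted_shift T wt) n)"
  show "0 \<in> ?D"
    unfolding dom_op_power_weighted_shift
    by (simp add: ell2_on_def shift_iter_def[abs_def] zero_ell2.rep_eq square_summable_zero)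
  show "f + g \<in> ?D" if "f \<in> ?D" "g \<in> ?D" for f g
  proof -
    have "shift_iter T wt k (ell2_apply (f + g))
        = (\<lambda>v. shift_iter T wt k (ell2_apply f) v + shift_iter T wt k (ell2_apply g) v)" for k
      by (simp add: shift_iter_def fun_eq_iff plus_ell2.rep_eq algebra_simps)
    with that show ?thesis
      unfolding dom_op_power_weighted_shift
      by (simp add: ell2_on_def plus_ell2.rep_eq square_summable_add)
  qed
  show "ell2_scale c f \<in> ?D" if "f \<in> ?D" for c f
  proof -
    have "shift_iter T wt k (ell2_apply (ell2_scale c f))
        = (\<lambda>v. c * shift_iter T wt k (ell2_apply f) v)" for k
      by (simp add: shift_iter_def fun_eq_iff ell2_scale.rep_eq)
    with that show ?thesis
      unfolding dom_op_power_weighted_shift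
      by (simp add: ell2_on_def ell2_scale.rep_eq square_summable_scale)
  qed
qed

lemma subspace_dom_infty:
  "ell2.subspace (dom_infty (ell2_on (pverts T)) (weighted_shift T wt))"
  unfolding dom_infty_def by (intro ell2.subspace_Inter) (auto intro: subspace_dom_op_power)

text \<open>Each iterate multiplies a composition with \<open>par T ^^ k\<close> by a fixed weight,
  so it preserves pointwise domination.\<close>

lemma dom_op_power_dominated:
  assumes f: "f \<in> dom (op_power (ell2_on (pverts T)) (weighted_shift T wt) n)"
    and le: "\<And>v. cmod (ell2_apply g v) \<le> cmod (ell2_apply f v)"
  shows "g \<in> dom (op_power (ell2_on (pverts T)) (weighted_shift T wt) n)"
  unfolding dom_op_power_weighted_shift
proof (intro conjI allI impI)
  show "g \<in> ell2_on (pverts T)"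
    unfolding ell2_on_def
  proof (intro CollectI allI impI)
    fix v assume "v \<notin> pverts T"
    moreover from f have "f \<in> ell2_on (pverts T)"
      unfolding dom_op_power_weighted_shift by blast
    ultimately have "ell2_apply f v = 0"
      by (simp add: ell2_on_def)
    with le[of v] show "ell2_apply g v = 0"
      by simp
  qed
  fix k assume "k \<le> n"
  with f have "square_summable (shift_iter T wt k (ell2_apply f))"
    unfolding dom_op_power_weighted_shift by blast
  then show "square_summable (shift_iter T wt k (ell2_apply g))"
    by (rule square_summable_mono) (simp add: shift_iter_def norm_mult mult_left_mono le)
qed

lemma ell2_unit_in_dom_op_power:
  assumes "dense_in (ell2_on (pverts T)) (dom (op_power (ell2_on (pverts T)) (weighted_shift T wt) n))"
    and u: "u \<in> pverts T"
  shows "ell2_unit u \<in> dom (op_power (ell2_on (pverts T)) (weighted_shift T wt) n)" (is "_ \<in> ?D")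
proof -
  have "ell2_unit u \<in> ell2_on (pverts T)"
    using u by (auto simp: ell2_on_def ell2_unit.rep_eq)
  with assms(1) have "ell2_unit u \<in> closure ?D"
    by (auto simp: dense_in_def)
  \<comment> \<open>Radius 1 suffices: it puts the value of \<open>f\<close> at \<open>u\<close> at
    distance less than 1 from 1, hence away from 0.\<close>
  then obtain f where f: "f \<in> ?D" "dist f (ell2_unit u) < 1"
    unfolding closure_approachable by (meson zero_less_one)
  have "cmod (ell2_apply f u - 1) < 1"
    using cmod_ell2_apply_le_norm[of "f - ell2_unit u" u] f(2)
    by (simp add: minus_ell2.rep_eq ell2_unit.rep_eq dist_norm)
  then have nz: "ell2_apply f u \<noteq> 0"
    by auto
  \<comment> \<open>The rescaled function has value 1 at \<open>u\<close>, so it dominates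
    \<open>ell2_unit u\<close>.\<close>
  have "ell2_scale (inverse (ell2_apply f u)) f \<in> ?D"
    using subspace_dom_op_power f(1) by (rule ell2.subspace_scale)
  then show ?thesis
    by (rule dom_op_power_dominated) (use nz in \<open>simp add: ell2_unit.rep_eq ell2_scale.rep_eq\<close>)
qed

section \<open>Restriction and cores\<close>

lemma op_power_ell2_restrict:
  assumes "op_power (ell2_on (pverts T)) (weighted_shift T wt) n f = Some g"
  shows "op_power (ell2_on (pverts T)) (weighted_shift T wt) n (ell2_restrict F f)
    = Some (ell2_restrict ((par T ^^ n) -` F) g)"
proof -
  let ?D = "dom (op_power (ell2_on (pverts T)) (weighted_shift T wt) n)"
  have f: "f \<in> ?D"
    using assms by blast
  have rf: "ell2_restrict F f \<in> ?D"
    using f by (rule dom_op_power_dominated) (simp add: ell2_restrict.rep_eq)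
  have g: "ell2_apply g = shift_iter T wt n (ell2_apply f)"
    using assms f unfolding dom_op_power_weighted_shift
    by (auto simp: op_power_weighted_shift ell2_apply_Abs)
  \<comment> \<open>The value at \<open>v\<close> reads the argument only at
    \<open>(par T ^^ n) v\<close>, so it survives or becomes 0 according to whether that point lies
    in \<open>F\<close>.\<close>
  have "shift_iter T wt n (ell2_apply (ell2_restrict F f))
      = ell2_apply (ell2_restrict ((par T ^^ n) -` F) g)"
    by (simp add: fun_eq_iff ell2_restrict.rep_eq g shift_iter_def)
  with rf show ?thesis
    unfolding dom_op_power_weighted_shift
    by (simp add: op_power_weighted_shift ell2_apply_inverse)
qed

lemma is_core_dom_infty:
  assumes "unit_span (pverts T) \<subseteq> dom_infty (ell2_on (pverts T)) (weighted_shift T wt)"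
  shows "is_core (dom_infty (ell2_on (pverts T)) (weighted_shift T wt))
    (op_power (ell2_on (pverts T)) (weighted_shift T wt) n)"
proof -
  define P where "P = op_power (ell2_on (pverts T)) (weighted_shift T wt) n"
  let ?E = "dom_infty (ell2_on (pverts T)) (weighted_shift T wt)"
  have "Map.graph P \<subseteq> closure (Map.graph (P |` ?E))"
  proof
    fix z assume "z \<in> Map.graph P"
    then obtain f g where z: "z = (f, g)" and fg: "P f = Some g"
      by (auto simp: Map.graph_def)
    have f: "f \<in> ell2_on (pverts T)"
      using fg dom_op_power_weighted_shift unfolding P_def by blast
    \<comment> \<open>One finite \<open>F\<close> cuts off both coordinates, so the pair stays on
      the graph of \<open>P\<close>.\<close>
    let ?Z = "\<lambda>F. (ell2_restrict F f, ell2_restrict ((par T ^^ n) -` F) g)"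
    have "(?Z \<longlongrightarrow> z) (finite_subsets_at_top UNIV)"
      unfolding z by (intro tendsto_Pair tendsto_ell2_restrict tendsto_ell2_restrict_vimage)
    then show "z \<in> closure (Map.graph (P |` ?E))"
    proof (rule Lim_in_closed_set[OF closed_closure, rotated 2])
      have "?Z F \<in> Map.graph (P |` ?E)" if "finite F" for F
      proof -
        have "ell2_restrict F f \<in> ?E"
          using ell2_restrict_in_unit_span[OF that f] assms by blast
        moreover have "P (ell2_restrict F f) = Some (ell2_restrict ((par T ^^ n) -` F) g)"
          using fg unfolding P_def by (rule op_power_ell2_restrict)
        ultimately show ?thesis
          by (simp add: Map.graph_def)
      qed
      then show "\<forall>\<^sub>F F in finite_subsets_at_top UNIV. ?Z F \<in> closure (Map.graph (P |` ?E))"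
        using closure_subset by (intro eventually_finite_subsets_at_top_weakI) blast
    qed simp
  qed
  then show ?thesis
    unfolding is_core_def P_def using subspace_dom_infty by (auto simp: dom_infty_def)
qed

theorem corollary3p2p3:
  fixes T :: "'v pair_pre_digraph" and wt :: "'v \<Rightarrow> complex"
    and V :: "'v set" and H :: "'v ell2 set" and S :: "'v ell2 \<rightharpoonup> 'v ell2"
  assumes "directed_tree T"
    and "V = pverts T"
    and "H = ell2_on V"
    and "S = weighted_shift T wt"
  shows "(unit_span V \<subseteq> dom_infty H S \<longleftrightarrow> dense_in H (dom_infty H S))
    \<and> (dense_in H (dom_infty H S) \<longleftrightarrow> (\<forall>n. densely_defined H (op_power H S n)))
    \<and> (unit_span V \<subseteq> dom_infty H S \<or> dense_in H (dom_infty H S)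
          \<or> (\<forall>n. densely_defined H (op_power H S n))
        \<longrightarrow> (\<forall>n. is_core (dom_infty H S) (op_power H S n)))"
proof -
  have dom_sub: "dom (op_power H S n) \<subseteq> H" for n
    unfolding assms(2-4) by (rule subsetI) (simp only: dom_op_power_weighted_shift)
  have inf_sub: "dom_infty H S \<subseteq> dom (op_power H S n)" for n
    by (auto simp: dom_infty_def)
  have i_ii: "dense_in H (dom_infty H S)" if "unit_span V \<subseteq> dom_infty H S"
    using ell2_on_subset_closure_unit_span[of V] closure_mono[OF that] inf_sub dom_sub
    unfolding dense_in_def assms(3) by blast
  have ii_iii: "densely_defined H (op_power H S n)" if "dense_in H (dom_infty H S)" for n
    using that closure_mono[OF inf_sub[of n]] dom_sub
    unfolding densely_defined_def dense_in_def by blast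
  have iii_i: "unit_span V \<subseteq> dom_infty H S" if "\<forall>n. densely_defined H (op_power H S n)"
  proof -
    have "ell2_unit ` V \<subseteq> dom_infty H S"
      using that unfolding densely_defined_def dom_infty_def assms(2-4)
      by (intro image_subsetI INT_I ell2_unit_in_dom_op_power) simp_all
    then show ?thesis
      using subspace_dom_infty unfolding unit_span_def assms(2-4) by (intro ell2.span_minimal)
  qed
  \<comment> \<open>Deriving the core property from (i) is enough, since (ii) gives (iii) and (iii)
    gives (i).\<close>
  have "is_core (dom_infty H S) (op_power H S n)" if "unit_span V \<subseteq> dom_infty H S" for n
    using is_core_dom_infty that unfolding assms(2-4) by blast
  with i_ii ii_iii iii_i show ?thesis
    by blast
qed

end
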